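(* The function classes $\mathcal{L}_{\mathrm{asym}}^*$, $\mathcal{L}_{\mathrm{H}}^*$ and $\mathcal{L}_{\mathrm{sym}}^*(\alpha)$ satisfy the following properties. 1. $\mathcal{L}_{\mathrm{asym}}^* \subset \mathcal{L}_{\mathrm{sym}}^*(1)$. 2. $\mathcal{L}_{\mathrm{H}}^* \subset \mathcal{L}_{\mathrm{sym}}^*(1)$. Moreover, these two classes coincide when restricted to the set of twice-differentiable functions. 3. For every $\alpha\in(0,1)$, the function $f(w)=|w|^{\frac{2-\alpha}{1-\alpha}}$, $w\in\mathbb{R}$, satisfies $f\in\mathcal{L}_{\mathrm{sym}}^*(\alpha)$. However, $f\notin\mathcal{L}_{\mathrm{sym}}^*(\widetilde{\alpha})$ for all $\widetilde{\alpha}\in(0,\alpha)$, and $f\notin\mathcal{L}_{\mathrm{asym}}^*$. 4. The function $f(w)=e^{w}+e^{-w}$, $w\in\mathbb{R}$, satisfies $f\in\mathcal{L}_{\mathrm{sym}}^*(1)$. However, $f\notin\mathcal{L}_{\mathrm{sym}}^*(\widetilde{\alpha})$ for all $\widetilde{\alpha}\in(0,1)$, and $f\notin\mathcal{L}_{\mathrm{asym}}^*$.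
   Context: Norms are Euclidean norms (operator norm for matrices). Convention: $0^0=1$. $\mathcal{L}_{\mathrm{asym}}^*$ is the class of differentiable $f:\mathbb{R}^d\to\mathbb{R}$ for which there are constants $L_0,L_1>0$ with $\|\nabla f(w')-\nabla f(w)\|\le (L_0+L_1\|\nabla f(w')\|)\|w'-w\|$ for all $w,w'\in\mathbb{R}^d$. $\mathcal{L}_{\mathrm{H}}^*$ is the class of twice-differentiable $f:\mathbb{R}^d\to\mathbb{R}$ for which there are constants $L_0,L_1>0$ with $\|\nabla^2 f(w)\|\le L_0+L_1\|\nabla f(w)\|$ for all $w\in\mathbb{R}^d$. For $\alpha\in[0,1]$, $\mathcal{L}_{\mathrm{sym}}^*(\alpha)$ is the class of differentiable $f:\mathbb{R}^d\to\mathbb{R}$ for which there are constants $L_0,L_1>0$ with $$\|\nabla f(w')-\nabla f(w)\|\le\Big(L_0+L_1\max_{\theta\in[0,1]}\|\nabla f(\theta w'+(1-\theta)w)\|^{\alpha}\Big)\|w'-w\|\quad\text{for all } w,w'\in\mathbb{R}^d.$$ In items 1 and 2, $\subset$ denotes proper inclusion. In items 3 and 4 the dimension is $d=1$. *)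

theory Defs
  imports "HOL-Analysis.Analysis"
begin

text \<open>Library \<^const>\<open>powr\<close> has \<open>0 powr 0 = 0\<close>; here the convention is \<open>0\<^sup>0 = 1\<close>.\<close>

definition rpow :: "real \<Rightarrow> real \<Rightarrow> real" where
  "rpow x a = (if a = 0 then 1 else x powr a)"

definition grad :: "('a::euclidean_space \<Rightarrow> real) \<Rightarrow> 'a \<Rightarrow> 'a" where
  "grad f x = (THE D. GDERIV f x :> D)"

lemma GDERIV_grad:
  fixes f :: "'a::euclidean_space \<Rightarrow> real"
  assumes "f differentiable (at x)"
  shows "GDERIV f x :> grad f x"
proof -
  from assms obtain f' where f': "(f has_derivative f') (at x)"
    by (auto simp: differentiable_def)
  then have "linear f'"
    by (rule has_derivative_linear)
  then have "f' = (\<lambda>h. h \<bullet> adjoint f' 1)"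
    using adjoint_works[of f' _ 1] by (simp add: fun_eq_iff)
  with f' have ex: "GDERIV f x :> adjoint f' 1"
    by (simp add: gderiv_def)
  have "D = E" if "GDERIV f x :> D" "GDERIV f x :> E" for D E
    using has_derivative_unique[OF that[unfolded gderiv_def]]
    by (metis vector_eq_ldot)
  with ex show ?thesis
    unfolding grad_def by (metis theI)
qed

definition twice_differentiable :: "('a::euclidean_space \<Rightarrow> real) \<Rightarrow> bool" where
  "twice_differentiable f \<longleftrightarrow>
    (\<forall>w. f differentiable (at w)) \<and> (\<forall>w. grad f differentiable (at w))"

text \<open>The Hessian as a linear map; its \<^const>\<open>onorm\<close> is the operator norm of the Hessian matrix
  (whereas \<^const>\<open>norm\<close> on a matrix type would be the Frobenius norm).\<close>

definition hessian :: "('a::euclidean_space \<Rightarrow> real) \<Rightarrow> 'a \<Rightarrow> 'a \<Rightarrow> 'a" where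
  "hessian f w = frechet_derivative (grad f) (at w)"

definition L_asym :: "('a::euclidean_space \<Rightarrow> real) set" where
  "L_asym = {f. (\<forall>w. f differentiable (at w)) \<and>
    (\<exists>L0>0. \<exists>L1>0. \<forall>w w'.
      norm (grad f w' - grad f w) \<le> (L0 + L1 * norm (grad f w')) * norm (w' - w))}"

definition L_H :: "('a::euclidean_space \<Rightarrow> real) set" where
  "L_H = {f. twice_differentiable f \<and>
    (\<exists>L0>0. \<exists>L1>0. \<forall>w. onorm (hessian f w) \<le> L0 + L1 * norm (grad f w))}"

text \<open>The maximum over the segment is taken at \<open>\<theta>\<close>. As the gradient is not assumed continuous,
  that this maximum exists is part of the condition.\<close>

definition L_sym :: "real \<Rightarrow> ('a::euclidean_space \<Rightarrow> real) set" where
  "L_sym \<alpha> = {f. (\<forall>w. f differentiable (at w)) \<and>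
    (\<exists>L0>0. \<exists>L1>0. \<forall>w w'.
      let g = (\<lambda>\<theta>::real. rpow (norm (grad f (\<theta> *\<^sub>R w' + (1 - \<theta>) *\<^sub>R w))) \<alpha>) in
      \<exists>\<theta>. is_arg_max g (\<lambda>\<theta>. \<theta> \<in> {0..1}) \<theta> \<and>
        norm (grad f w' - grad f w) \<le> (L0 + L1 * g \<theta>) * norm (w' - w))}"

end

theory Submission
  imports Defs "HOL-Real_Asymp.Real_Asymp"
begin

text \<open>Every membership in \<open>L_sym\<close> has the same source: if the gradient is continuous, the
  maximum over a segment exists, and an estimate of the gradient increment by \<^emph>\<open>any\<close> upper bound
  \<open>M\<close> of \<open>\<parallel>\<nabla>f\<parallel>\<^sup>\<alpha>\<close> on the segment suffices (\<open>L_symI\<close>). The asymmetric condition gives continuity by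
  letting \<open>w \<rightarrow> w'\<close>, and the end point \<open>w'\<close> lies on the segment. A Hessian bound
  \<open>\<parallel>\<nabla>\<^sup>2f\<parallel> \<le> L0 + L1 \<parallel>\<nabla>f\<parallel>\<^sup>\<alpha>\<close> gives the estimate by the mean value inequality
  (\<open>hessian_bound_imp_L_sym\<close>). Conversely, if \<open>f \<in> L_sym 1\<close> has a differentiable gradient,
  shrinking the segment to the point \<open>w\<close> makes \<open>\<nabla>f\<close> Lipschitz near \<open>w\<close> with a constant as close as
  desired to \<open>L0 + L1 \<parallel>\<nabla>f w\<parallel>\<close>, which then bounds the Hessian (\<open>L_sym_1_imp_L_H\<close>).

  The examples are ridge functions \<open>x \<mapsto> \<phi> (x \<bullet> b)\<close> with a coordinate vector \<open>b\<close>, which live on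
  every Euclidean space and on \<open>\<real>\<close> itself with \<open>b = 1\<close>. Here \<open>\<phi> t = exp t + exp (- t)\<close> has
  \<open>\<phi>'' \<le> 2 + \<bar>\<phi>'\<bar>\<close>, whereas \<open>\<phi> t = sgn t * \<bar>t\<bar>\<^sup>2\<close> has the Lipschitz but nondifferentiable derivative
  \<open>2 * \<bar>t\<bar>\<close>. The power \<open>\<bar>t\<bar>\<^sup>p\<close> with \<open>p = (2 - \<alpha>) / (1 - \<alpha>)\<close> has \<open>\<bar>\<phi>'\<bar> = p \<bar>t\<bar>\<^sup>q\<close> for
  \<open>q = 1 / (1 - \<alpha>)\<close>, and \<open>q - 1 = q * \<alpha>\<close> makes \<open>\<phi>''\<close> a multiple of \<open>\<bar>\<phi>'\<bar>\<^sup>\<alpha>\<close>.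

  Apart from nondifferentiability of \<open>2 * \<bar>t\<bar>\<close> at \<open>0\<close>, which separates \<open>L_H\<close> from \<open>L_sym 1\<close>, all
  non-memberships come from comparing \<open>\<nabla>f\<close> at \<open>0\<close>, where it vanishes, and at a
  large \<open>x\<close>: membership in \<open>L_asym\<close> forces linear growth of \<open>\<nabla>f\<close>, and membership in \<open>L_sym \<beta>\<close> with
  \<open>\<bar>f'\<bar>\<close> increasing on \<open>[0, \<infinity>)\<close> forces \<open>\<bar>f' x\<bar> \<le> (L0 + L1 \<bar>f' x\<bar>\<^sup>\<beta>) x\<close>. For the exponential this
  fails as soon as \<open>\<beta> < 1\<close>; for the power it would need \<open>q \<le> q * \<beta> + 1\<close>, that is \<open>\<beta> \<ge> \<alpha>\<close>.\<close>

section \<open>Gradients and the existence of the maximum\<close>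

lemma grad_eqI:
  fixes f :: "'a::euclidean_space \<Rightarrow> real"
  assumes "GDERIV f x :> D"
  shows "grad f x = D"
proof -
  have "f differentiable (at x)"
    using assms by (auto simp: gderiv_def differentiable_def)
  then have "GDERIV f x :> grad f x" by (rule GDERIV_grad)
  from has_derivative_unique[OF this[unfolded gderiv_def] assms[unfolded gderiv_def]]
  show ?thesis by (metis vector_eq_ldot)
qed

lemma rpow_nonneg: "rpow x a \<ge> 0"
  by (simp add: rpow_def)

lemma rpow_1: "x \<ge> 0 \<Longrightarrow> rpow x 1 = x"
  by (simp add: rpow_def)

lemma rpow_mono:
  assumes "0 \<le> x" "x \<le> y" "0 \<le> a"
  shows "rpow x a \<le> rpow y a"
  using assms by (simp add: rpow_def powr_mono2)

lemma continuous_on_rpow: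
  fixes g :: "'a::topological_space \<Rightarrow> real"
  assumes "continuous_on S g" "\<And>x. x \<in> S \<Longrightarrow> g x \<ge> 0" "a \<ge> 0"
  shows "continuous_on S (\<lambda>x. rpow (g x) a)"
proof (cases "a = 0")
  case False
  then have "continuous_on S (\<lambda>x. g x powr a)"
    using assms by (intro continuous_on_powr') auto
  then show ?thesis using False by (simp add: rpow_def)
qed (simp add: rpow_def)

text \<open>The maximum is replaced by an arbitrary upper bound \<open>M\<close>, so that uses of this rule do not have
  to deal with a maximizer.\<close>

lemma L_symI:
  fixes f :: "'a::euclidean_space \<Rightarrow> real"
  assumes diff: "\<And>w. f differentiable (at w)"
    and cont: "continuous_on UNIV (grad f)"
    and "\<alpha> \<ge> 0" "L0 > 0" "L1 > 0"
    and bound: "\<And>w w' M.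
      (\<And>\<theta>. \<theta> \<in> {0..1} \<Longrightarrow> rpow (norm (grad f (\<theta> *\<^sub>R w' + (1 - \<theta>) *\<^sub>R w))) \<alpha> \<le> M)
        \<Longrightarrow> norm (grad f w' - grad f w) \<le> (L0 + L1 * M) * norm (w' - w)"
  shows "f \<in> L_sym \<alpha>"
proof -
  have max: "\<exists>\<theta>. is_arg_max (\<lambda>\<theta>::real. rpow (norm (grad f (\<theta> *\<^sub>R w' + (1 - \<theta>) *\<^sub>R w))) \<alpha>)
        (\<lambda>\<theta>. \<theta> \<in> {0..1}) \<theta> \<and>
        norm (grad f w' - grad f w)
          \<le> (L0 + L1 * rpow (norm (grad f (\<theta> *\<^sub>R w' + (1 - \<theta>) *\<^sub>R w))) \<alpha>) * norm (w' - w)"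
    for w w'
  proof -
    let ?g = "\<lambda>\<theta>::real. rpow (norm (grad f (\<theta> *\<^sub>R w' + (1 - \<theta>) *\<^sub>R w))) \<alpha>"
    have "continuous_on {0..1} (\<lambda>\<theta>::real. grad f (\<theta> *\<^sub>R w' + (1 - \<theta>) *\<^sub>R w))"
      by (rule continuous_on_compose2[OF cont]) (auto intro!: continuous_intros)
    then have "continuous_on {0..1} ?g"
      using \<open>\<alpha> \<ge> 0\<close> by (intro continuous_on_rpow continuous_on_norm) auto
    then obtain \<theta> where \<theta>: "\<theta> \<in> {0..1}" "\<And>t. t \<in> {0..1} \<Longrightarrow> ?g t \<le> ?g \<theta>"
      using continuous_attains_sup[of "{0..1::real}" ?g] by auto
    have "is_arg_max ?g (\<lambda>\<theta>. \<theta> \<in> {0..1}) \<theta>"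
      using \<theta> by (force simp: is_arg_max_def not_less)
    moreover have "norm (grad f w' - grad f w) \<le> (L0 + L1 * ?g \<theta>) * norm (w' - w)"
      using \<theta>(2) by (rule bound)
    ultimately show ?thesis by blast
  qed
  show ?thesis
    unfolding L_sym_def Let_def using diff \<open>L0 > 0\<close> \<open>L1 > 0\<close> max by blast
qed

lemma L_symE:
  fixes f :: "'a::euclidean_space \<Rightarrow> real"
  assumes "f \<in> L_sym \<alpha>"
  obtains L0 L1 where "L0 > 0" "L1 > 0"
    "\<And>w w'. \<exists>\<theta>::real. \<theta> \<in> {0..1} \<and>
      norm (grad f w' - grad f w) \<le>
        (L0 + L1 * rpow (norm (grad f (\<theta> *\<^sub>R w' + (1 - \<theta>) *\<^sub>R w))) \<alpha>) * norm (w' - w)"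
proof -
  from assms obtain L0 L1 where L: "L0 > 0" "L1 > 0"
    and S: "\<forall>w w'. let g = (\<lambda>\<theta>::real. rpow (norm (grad f (\<theta> *\<^sub>R w' + (1 - \<theta>) *\<^sub>R w))) \<alpha>) in
      \<exists>\<theta>. is_arg_max g (\<lambda>\<theta>. \<theta> \<in> {0..1}) \<theta> \<and>
        norm (grad f w' - grad f w) \<le> (L0 + L1 * g \<theta>) * norm (w' - w)"
    unfolding L_sym_def mem_Collect_eq by (elim conjE exE) (rule that)
  show thesis
  proof (rule that[OF L])
    fix w w' :: 'a
    show "\<exists>\<theta>::real. \<theta> \<in> {0..1} \<and>
      norm (grad f w' - grad f w) \<le>
        (L0 + L1 * rpow (norm (grad f (\<theta> *\<^sub>R w' + (1 - \<theta>) *\<^sub>R w))) \<alpha>) * norm (w' - w)"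
      using S[rule_format, of w' w] by (auto simp: Let_def is_arg_max_def)
  qed
qed

section \<open>The inclusions between the classes\<close>

text \<open>Continuity of the gradient at \<open>z\<close> comes from fixing \<open>w' = z\<close>, so that the constant in front of
  \<open>norm (z - w)\<close> does not depend on \<open>w\<close>.\<close>

lemma L_asym_subset_L_sym_1:
  "(L_asym :: ('a::euclidean_space \<Rightarrow> real) set) \<subseteq> L_sym 1"
proof
  fix f :: "'a \<Rightarrow> real"
  assume "f \<in> L_asym"
  then obtain L0 L1 where diff: "\<And>w. f differentiable (at w)" and L: "L0 > 0" "L1 > 0"
    and A: "\<And>w w'. norm (grad f w' - grad f w) \<le> (L0 + L1 * norm (grad f w')) * norm (w' - w)"
    unfolding L_asym_def by blast
  have "isCont (grad f) z" for z
  proof -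
    have "((\<lambda>w. (L0 + L1 * norm (grad f z)) * norm (z - w))
        \<longlongrightarrow> (L0 + L1 * norm (grad f z)) * norm (z - z)) (at z)"
      by (intro tendsto_intros)
    then have lim: "((\<lambda>w. (L0 + L1 * norm (grad f z)) * norm (z - w)) \<longlongrightarrow> 0) (at z)"
      by simp
    have "norm (grad f w - grad f z) \<le> (L0 + L1 * norm (grad f z)) * norm (z - w)" for w
      using A[of z w] by (simp add: norm_minus_commute)
    then have "((\<lambda>w. grad f w - grad f z) \<longlongrightarrow> 0) (at z)"
      by (intro Lim_null_comparison[OF always_eventually lim]) blast
    then show ?thesis by (simp add: isCont_def LIM_zero_iff)
  qed
  then have cont: "continuous_on UNIV (grad f)"
    by (simp add: continuous_on_eq_continuous_at)
  show "f \<in> L_sym 1"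
  proof (rule L_symI[OF diff cont _ L])
    fix w w' :: 'a and M
    assume M: "\<And>\<theta>. \<theta> \<in> {0..1} \<Longrightarrow> rpow (norm (grad f (\<theta> *\<^sub>R w' + (1 - \<theta>) *\<^sub>R w))) 1 \<le> M"
    have "norm (grad f w') \<le> M" using M[of 1] by (simp add: rpow_1)
    then have "(L0 + L1 * norm (grad f w')) * norm (w' - w) \<le> (L0 + L1 * M) * norm (w' - w)"
      using L by (intro mult_right_mono add_left_mono mult_left_mono) auto
    with A[of w' w] show "norm (grad f w' - grad f w) \<le> (L0 + L1 * M) * norm (w' - w)"
      by linarith
  qed simp
qed

text \<open>The mean value inequality on the segment: the Hessian at each of its points is controlled by the
  gradient there, hence by the bound \<open>M\<close>.\<close>

lemma hessian_bound_imp_L_sym: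
  fixes f :: "'a::euclidean_space \<Rightarrow> real"
  assumes tw: "twice_differentiable f" and "\<alpha> \<ge> 0" and L: "L0 > 0" "L1 > 0"
    and H: "\<And>w. onorm (hessian f w) \<le> L0 + L1 * rpow (norm (grad f w)) \<alpha>"
  shows "f \<in> L_sym \<alpha>"
proof (rule L_symI[OF _ _ \<open>\<alpha> \<ge> 0\<close> L])
  show "f differentiable (at w)" for w
    using tw by (simp add: twice_differentiable_def)
  have D: "(grad f has_derivative hessian f w) (at w)" for w
    using tw by (simp add: twice_differentiable_def hessian_def frechet_derivative_works)
  then show "continuous_on UNIV (grad f)"
    by (meson continuous_at_imp_continuous_on has_derivative_continuous)
  fix w w' :: 'a and M
  assume M: "\<And>\<theta>. \<theta> \<in> {0..1} \<Longrightarrow> rpow (norm (grad f (\<theta> *\<^sub>R w' + (1 - \<theta>) *\<^sub>R w))) \<alpha> \<le> M"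
  show "norm (grad f w' - grad f w) \<le> (L0 + L1 * M) * norm (w' - w)"
  proof (rule differentiable_bound[of "closed_segment w w'"])
    show "(grad f has_derivative hessian f x) (at x within closed_segment w w')" for x
      using D by (rule has_derivative_at_withinI)
    fix x assume "x \<in> closed_segment w w'"
    then obtain u where "0 \<le> u" "u \<le> 1" "x = u *\<^sub>R w' + (1 - u) *\<^sub>R w"
      by (auto simp: closed_segment_def add.commute)
    then have "rpow (norm (grad f x)) \<alpha> \<le> M" using M[of u] by simp
    then have "L1 * rpow (norm (grad f x)) \<alpha> \<le> L1 * M" using L by simp
    with H[of x] show "onorm (hessian f x) \<le> L0 + L1 * M" by linarith
  qed auto
qed

lemma L_H_subset_L_sym_1:
  "(L_H :: ('a::euclidean_space \<Rightarrow> real) set) \<subseteq> L_sym 1"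
proof
  fix f :: "'a \<Rightarrow> real"
  assume "f \<in> L_H"
  then obtain L0 L1 where "twice_differentiable f" "L0 > 0" "L1 > 0"
    "\<And>w. onorm (hessian f w) \<le> L0 + L1 * norm (grad f w)"
    unfolding L_H_def by blast
  then show "f \<in> L_sym 1"
    by (intro hessian_bound_imp_L_sym[of f 1 L0 L1]) (auto simp: rpow_1)
qed

text \<open>The derivative maps \<open>y - x\<close> to within \<open>e * norm (y - x)\<close> of the increment for \<open>y\<close> near \<open>x\<close>, and
  by linearity these differences already determine its operator norm.\<close>

lemma onorm_derivative_le_Lipschitz_at:
  fixes F :: "'a::real_normed_vector \<Rightarrow> 'b::real_normed_vector"
  assumes D: "(F has_derivative F') (at x)" and "K \<ge> 0" "d > 0"
    and lip: "\<And>y. norm (y - x) < d \<Longrightarrow> norm (F y - F x) \<le> K * norm (y - x)"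
  shows "onorm F' \<le> K"
proof (rule field_le_epsilon)
  fix e :: real assume "e > 0"
  have lin: "bounded_linear F'" using D by (rule has_derivative_bounded_linear)
  from D \<open>e > 0\<close> obtain d' where "d' > 0"
    and d': "\<And>y. norm (y - x) < d' \<Longrightarrow> norm (F y - F x - F' (y - x)) \<le> e * norm (y - x)"
    unfolding has_derivative_at_alt by blast
  have "norm (F' h) \<le> (K + e) * norm h" for h
  proof (cases "h = 0")
    case True
    then show ?thesis using lin by (simp add: linear_simps)
  next
    case False
    define t where "t = min d d' / 2 / norm h"
    have t: "t > 0" using False \<open>d > 0\<close> \<open>d' > 0\<close> by (simp add: t_def)
    have "norm (t *\<^sub>R h) = min d d' / 2"
      using False \<open>d > 0\<close> \<open>d' > 0\<close> by (simp add: t_def)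
    then have "norm (t *\<^sub>R h) < d" "norm (t *\<^sub>R h) < d'"
      using \<open>d > 0\<close> \<open>d' > 0\<close> by linarith+
    with lip[of "x + t *\<^sub>R h"] d'[of "x + t *\<^sub>R h"]
    have "norm (F (x + t *\<^sub>R h) - F x) \<le> K * norm (t *\<^sub>R h)"
      "norm (F (x + t *\<^sub>R h) - F x - F' (t *\<^sub>R h)) \<le> e * norm (t *\<^sub>R h)"
      by simp_all
    then have "norm (F' (t *\<^sub>R h)) \<le> (K + e) * norm (t *\<^sub>R h)"
      using norm_triangle_ineq2[of "F' (t *\<^sub>R h)" "F (x + t *\<^sub>R h) - F x"]
      by (simp add: norm_minus_commute algebra_simps)
    then have "t * norm (F' h) \<le> t * ((K + e) * norm h)"
      using t lin by (simp add: linear_simps algebra_simps)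
    then show ?thesis using t by simp
  qed
  then show "onorm F' \<le> K + e"
    using \<open>K \<ge> 0\<close> \<open>e > 0\<close> by (intro onorm_bound) auto
qed

text \<open>Near \<open>w\<close> the whole segment from \<open>w\<close> to \<open>y\<close> stays in a ball where continuity keeps \<open>\<parallel>\<nabla>f\<parallel>\<close> below
  \<open>\<parallel>\<nabla>f w\<parallel> + e / L1\<close>, wherever the maximum happens to be attained. The same constants \<open>L0\<close> and \<open>L1\<close>
  serve both classes.\<close>

lemma L_sym_1_imp_L_H:
  fixes f :: "'a::euclidean_space \<Rightarrow> real"
  assumes "f \<in> L_sym 1" and tw: "twice_differentiable f"
  shows "f \<in> L_H"
proof -
  from L_symE[OF assms(1)] obtain L0 L1 where L: "L0 > 0" "L1 > 0"
    and S: "\<And>w w'. \<exists>\<theta>::real. \<theta> \<in> {0..1} \<and>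
      norm (grad f w' - grad f w) \<le>
        (L0 + L1 * rpow (norm (grad f (\<theta> *\<^sub>R w' + (1 - \<theta>) *\<^sub>R w))) 1) * norm (w' - w)"
    by blast
  have "onorm (hessian f w) \<le> L0 + L1 * norm (grad f w)" for w
  proof (rule field_le_epsilon)
    fix e :: real assume "e > 0"
    have D: "(grad f has_derivative hessian f w) (at w)"
      using tw by (simp add: twice_differentiable_def hessian_def frechet_derivative_works)
    then have "isCont (grad f) w" by (rule has_derivative_continuous)
    moreover have "e / L1 > 0" using \<open>e > 0\<close> L by simp
    ultimately obtain d where "d > 0"
      and d: "\<And>y. dist y w < d \<Longrightarrow> dist (grad f y) (grad f w) < e / L1"
      unfolding continuous_at_eps_delta by blast
    show "onorm (hessian f w) \<le> L0 + L1 * norm (grad f w) + e"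
    proof (rule onorm_derivative_le_Lipschitz_at[OF D _ \<open>d > 0\<close>])
      show "0 \<le> L0 + L1 * norm (grad f w) + e" using L \<open>e > 0\<close> by simp
      fix y assume y: "norm (y - w) < d"
      obtain \<theta> where \<theta>: "\<theta> \<in> {0..1}" and
        B: "norm (grad f y - grad f w) \<le>
          (L0 + L1 * norm (grad f (\<theta> *\<^sub>R y + (1 - \<theta>) *\<^sub>R w))) * norm (y - w)"
        using S[of y w] by (auto simp: rpow_1)
      let ?z = "\<theta> *\<^sub>R y + (1 - \<theta>) *\<^sub>R w"
      have "?z - w = \<theta> *\<^sub>R (y - w)" by (simp add: algebra_simps)
      then have "norm (?z - w) = \<theta> * norm (y - w)" using \<theta> by simp
      also have "\<dots> \<le> 1 * norm (y - w)" using \<theta> by (intro mult_right_mono) auto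
      finally have "dist ?z w < d" using y by (simp add: dist_norm)
      from d[OF this] have "norm (grad f ?z) \<le> norm (grad f w) + e / L1"
        using norm_triangle_ineq2[of "grad f ?z" "grad f w"] by (simp add: dist_norm)
      then have "L1 * norm (grad f ?z) \<le> L1 * (norm (grad f w) + e / L1)"
        using L by (intro mult_left_mono) auto
      then have "L1 * norm (grad f ?z) \<le> L1 * norm (grad f w) + e"
        using L by (simp add: distrib_left)
      then have "(L0 + L1 * norm (grad f ?z)) * norm (y - w)
          \<le> (L0 + L1 * norm (grad f w) + e) * norm (y - w)"
        by (intro mult_right_mono) auto
      with B show "norm (grad f y - grad f w) \<le> (L0 + L1 * norm (grad f w) + e) * norm (y - w)"
        by linarith
    qed
  qed
  then show ?thesis unfolding L_H_def using tw L by blast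
qed

section \<open>Growth obstructions\<close>

text \<open>The asymmetric condition weights the gradient at \<open>w'\<close> only; at the critical point \<open>w' = 0\<close> the term
  with \<open>L1\<close> disappears.\<close>

lemma L_asym_imp_linear_growth:
  fixes f :: "'a::euclidean_space \<Rightarrow> real"
  assumes "f \<in> L_asym" "grad f 0 = 0"
  shows "\<exists>L>0. \<forall>x. norm (grad f x) \<le> L * norm x"
proof -
  from assms(1) obtain L0 L1 where "L0 > 0"
    and A: "\<And>w w'. norm (grad f w' - grad f w) \<le> (L0 + L1 * norm (grad f w')) * norm (w' - w)"
    unfolding L_asym_def by blast
  have "norm (grad f x) \<le> L0 * norm x" for x
    using A[of 0 x] assms(2) by simp
  with \<open>L0 > 0\<close> show ?thesis by blast
qed

text \<open>By monotonicity the maximum over \<open>[0, x]\<close> is at most the value at \<open>x\<close>, so the condition becomes a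
  self-referential growth bound on \<open>\<bar>f'\<bar>\<close>.\<close>

lemma L_sym_imp_growth:
  fixes f :: "real \<Rightarrow> real"
  assumes "f \<in> L_sym \<beta>" "\<beta> \<ge> 0" "grad f 0 = 0"
    and mono: "\<And>x y. 0 \<le> x \<Longrightarrow> x \<le> y \<Longrightarrow> \<bar>grad f x\<bar> \<le> \<bar>grad f y\<bar>"
  shows "\<exists>L0>0. \<exists>L1>0. \<forall>x\<ge>0. \<bar>grad f x\<bar> \<le> (L0 + L1 * rpow \<bar>grad f x\<bar> \<beta>) * x"
proof -
  from L_symE[OF assms(1)] obtain L0 L1 where L: "L0 > 0" "L1 > 0"
    and S: "\<And>w w'. \<exists>\<theta>::real. \<theta> \<in> {0..1} \<and>
      norm (grad f w' - grad f w) \<le>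
        (L0 + L1 * rpow (norm (grad f (\<theta> *\<^sub>R w' + (1 - \<theta>) *\<^sub>R w))) \<beta>) * norm (w' - w)"
    by blast
  have "\<bar>grad f x\<bar> \<le> (L0 + L1 * rpow \<bar>grad f x\<bar> \<beta>) * x" if x: "x \<ge> 0" for x
  proof -
    obtain \<theta> where \<theta>: "\<theta> \<in> {0..1}"
      and B: "\<bar>grad f x\<bar> \<le> (L0 + L1 * rpow \<bar>grad f (\<theta> * x)\<bar> \<beta>) * x"
      using S[of x 0] x assms(3) by auto
    have "\<theta> * x \<le> 1 * x" using \<theta> x by (intro mult_right_mono) auto
    then have "rpow \<bar>grad f (\<theta> * x)\<bar> \<beta> \<le> rpow \<bar>grad f x\<bar> \<beta>"
      using mono[of "\<theta> * x" x] \<theta> x \<open>\<beta> \<ge> 0\<close> by (intro rpow_mono) auto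
    then have "(L0 + L1 * rpow \<bar>grad f (\<theta> * x)\<bar> \<beta>) * x \<le> (L0 + L1 * rpow \<bar>grad f x\<bar> \<beta>) * x"
      using L x by (intro mult_right_mono add_left_mono mult_left_mono) auto
    with B show ?thesis by linarith
  qed
  with L show ?thesis by blast
qed

section \<open>Ridge functions\<close>

lemma GDERIV_ridge:
  fixes b :: "'a::euclidean_space"
  assumes "(\<phi> has_real_derivative D) (at (x \<bullet> b))"
  shows "GDERIV (\<lambda>x. \<phi> (x \<bullet> b)) x :> D *\<^sub>R b"
proof -
  have "((\<lambda>x. \<phi> (x \<bullet> b)) has_derivative (\<lambda>h. D * (h \<bullet> b))) (at x)"
    using assms unfolding has_field_derivative_def
    by (intro has_derivative_compose[where f = "\<lambda>x. x \<bullet> b" and g = \<phi>] has_derivative_inner_left)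
      auto
  then show ?thesis by (simp add: gderiv_def)
qed

lemma grad_ridge:
  fixes b :: "'a::euclidean_space"
  assumes "\<And>t. (\<phi> has_real_derivative \<phi>' t) (at t)"
  shows "grad (\<lambda>x. \<phi> (x \<bullet> b)) = (\<lambda>x. \<phi>' (x \<bullet> b) *\<^sub>R b)"
  using grad_eqI[OF GDERIV_ridge[OF assms]] by blast

lemma differentiable_ridge:
  fixes b :: "'a::euclidean_space"
  assumes "\<And>t. (\<phi> has_real_derivative \<phi>' t) (at t)"
  shows "(\<lambda>x. \<phi> (x \<bullet> b)) differentiable (at x)"
  using GDERIV_ridge[OF assms, of b x] by (auto simp: gderiv_def differentiable_def)

lemma twice_differentiable_ridge:
  fixes b :: "'a::euclidean_space"
  assumes b: "b \<in> Basis"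
    and D1: "\<And>t. (\<phi> has_real_derivative \<phi>' t) (at t)"
    and D2: "\<And>t. (\<phi>' has_real_derivative \<phi>'' t) (at t)"
  shows "twice_differentiable (\<lambda>x. \<phi> (x \<bullet> b))"
    and "onorm (hessian (\<lambda>x. \<phi> (x \<bullet> b)) x) \<le> \<bar>\<phi>'' (x \<bullet> b)\<bar>"
proof -
  let ?f = "\<lambda>x. \<phi> (x \<bullet> b)"
  have D: "(grad ?f has_derivative (\<lambda>h. (\<phi>'' (x \<bullet> b) * (h \<bullet> b)) *\<^sub>R b)) (at x)" for x
  proof -
    have "((\<lambda>x. \<phi>' (x \<bullet> b)) has_derivative (\<lambda>h. \<phi>'' (x \<bullet> b) * (h \<bullet> b))) (at x)"
      using GDERIV_ridge[OF D2, of b x] by (simp add: gderiv_def)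
    then show ?thesis
      unfolding grad_ridge[OF D1] by (rule has_derivative_scaleR_left)
  qed
  then show "twice_differentiable ?f"
    unfolding twice_differentiable_def using differentiable_ridge[OF D1]
    by (auto simp: differentiable_def)
  have "hessian ?f x = (\<lambda>h. (\<phi>'' (x \<bullet> b) * (h \<bullet> b)) *\<^sub>R b)"
    unfolding hessian_def using frechet_derivative_at[OF D] by simp
  moreover have "\<bar>\<phi>'' (x \<bullet> b)\<bar> * \<bar>h \<bullet> b\<bar> \<le> \<bar>\<phi>'' (x \<bullet> b)\<bar> * norm h" for h
    using b by (intro mult_left_mono) (auto simp: Basis_le_norm)
  ultimately show "onorm (hessian ?f x) \<le> \<bar>\<phi>'' (x \<bullet> b)\<bar>"
    using b by (intro onorm_bound) (auto simp: abs_mult)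
qed

lemma ridge_in_L_sym:
  fixes b :: "'a::euclidean_space"
  assumes b: "b \<in> Basis"
    and D1: "\<And>t. (\<phi> has_real_derivative \<phi>' t) (at t)"
    and D2: "\<And>t. (\<phi>' has_real_derivative \<phi>'' t) (at t)"
    and "\<alpha> \<ge> 0" "L0 > 0" "L1 > 0"
    and bound: "\<And>t. \<bar>\<phi>'' t\<bar> \<le> L0 + L1 * rpow \<bar>\<phi>' t\<bar> \<alpha>"
  shows "(\<lambda>x. \<phi> (x \<bullet> b)) \<in> L_sym \<alpha>"
proof (rule hessian_bound_imp_L_sym[OF twice_differentiable_ridge(1)[OF b D1 D2] assms(4-6)])
  fix w
  have "onorm (hessian (\<lambda>x. \<phi> (x \<bullet> b)) w) \<le> \<bar>\<phi>'' (w \<bullet> b)\<bar>"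
    by (rule twice_differentiable_ridge(2)[OF b D1 D2])
  also have "\<dots> \<le> L0 + L1 * rpow \<bar>\<phi>' (w \<bullet> b)\<bar> \<alpha>" by (rule bound)
  finally show "onorm (hessian (\<lambda>x. \<phi> (x \<bullet> b)) w)
      \<le> L0 + L1 * rpow (norm (grad (\<lambda>x. \<phi> (x \<bullet> b)) w)) \<alpha>"
    using b by (simp add: grad_ridge[OF D1])
qed

section \<open>The symmetrized exponential\<close>

lemma DERIV_cosh_like:
  "((\<lambda>t::real. exp t + exp (- t)) has_real_derivative exp t - exp (- t)) (at t)"
  "((\<lambda>t::real. exp t - exp (- t)) has_real_derivative exp t + exp (- t)) (at t)"
  by (auto intro!: derivative_eq_intros)

text \<open>One of \<open>exp t\<close> and \<open>exp (- t)\<close> is at most \<open>1\<close>, so their sum exceeds the absolute value of their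
  difference by at most \<open>2\<close>.\<close>

lemma exp_ridge_in_L_sym_1:
  fixes b :: "'a::euclidean_space"
  assumes "b \<in> Basis"
  shows "(\<lambda>x. exp (x \<bullet> b) + exp (- (x \<bullet> b))) \<in> L_sym 1"
proof (rule ridge_in_L_sym[OF assms DERIV_cosh_like, of 1 2 1])
  fix t :: real
  have "exp t \<le> 1 \<or> exp (- t) \<le> 1" by (cases "t \<le> 0") auto
  then show "\<bar>exp t + exp (- t)\<bar> \<le> 2 + 1 * rpow \<bar>exp t - exp (- t)\<bar> 1"
    by (auto simp: rpow_1 abs_if)
qed auto

lemma exp_ridge_notin_L_asym:
  fixes b :: "'a::euclidean_space"
  assumes b: "b \<in> Basis"
  shows "(\<lambda>x. exp (x \<bullet> b) + exp (- (x \<bullet> b))) \<notin> L_asym"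
proof
  assume "(\<lambda>x. exp (x \<bullet> b) + exp (- (x \<bullet> b))) \<in> L_asym"
  from L_asym_imp_linear_growth[OF this]
  obtain L where L: "\<And>x. \<bar>exp (x \<bullet> b) - exp (- (x \<bullet> b))\<bar> \<le> L * norm x" "L > 0"
    using b by (auto simp: grad_ridge[OF DERIV_cosh_like(1)])
  have "eventually (\<lambda>t::real. exp t - exp (- t) > L * t) at_top"
    using \<open>L > 0\<close> by real_asymp
  then have "eventually (\<lambda>t::real. exp t - exp (- t) > L * t \<and> t > 0) at_top"
    using eventually_gt_at_top[of 0] by (rule eventually_conj)
  then obtain t :: real where "exp t - exp (- t) > L * t" "t > 0"
    by (auto simp: eventually_at_top_linorder)
  with L(1)[of "t *\<^sub>R b"] b show False by simp
qed

lemma grad_exp_real: "grad (\<lambda>w::real. exp w + exp (- w)) = (\<lambda>w. exp w - exp (- w))"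
  using grad_ridge[OF DERIV_cosh_like(1), of "1::real"] by simp

lemma exp_notin_L_sym:
  assumes \<beta>: "0 < \<beta>" "\<beta> < 1"
  shows "(\<lambda>w::real. exp w + exp (- w)) \<notin> L_sym \<beta>"
proof
  let ?f = "\<lambda>w::real. exp w + exp (- w)"
  assume f: "?f \<in> L_sym \<beta>"
  have mono: "\<bar>grad ?f x\<bar> \<le> \<bar>grad ?f y\<bar>" if "0 \<le> x" "x \<le> y" for x y
  proof -
    have "exp x \<ge> exp (- x)" "exp x \<le> exp y" "exp (- y) \<le> exp (- x)"
      using that by auto
    then show ?thesis unfolding grad_exp_real by linarith
  qed
  have "grad ?f 0 = 0" by (simp add: grad_exp_real)
  from L_sym_imp_growth[OF f less_imp_le[OF \<beta>(1)] this mono] obtain L0 L1 where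
    L: "L0 > 0" "L1 > 0" and G: "\<And>x. x \<ge> 0 \<Longrightarrow>
      \<bar>exp x - exp (- x)\<bar> \<le> (L0 + L1 * rpow \<bar>exp x - exp (- x)\<bar> \<beta>) * x"
    unfolding grad_exp_real by blast
  have "eventually (\<lambda>x::real.
      exp x - exp (- x) > (L0 + L1 * (exp x - exp (- x)) powr \<beta>) * x) at_top"
    using \<beta> L by real_asymp
  then have "eventually (\<lambda>x::real.
      exp x - exp (- x) > (L0 + L1 * (exp x - exp (- x)) powr \<beta>) * x \<and> x > 0) at_top"
    using eventually_gt_at_top[of 0] by (rule eventually_conj)
  then obtain x :: real where
    x: "exp x - exp (- x) > (L0 + L1 * (exp x - exp (- x)) powr \<beta>) * x" "x > 0"
    by (auto simp: eventually_at_top_linorder)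
  have "\<bar>exp x - exp (- x)\<bar> = exp x - exp (- x)" using x(2) by simp
  with G[of x] x \<beta> show False by (simp add: rpow_def)
qed

section \<open>Powers of the absolute value\<close>

lemma DERIV_zero_if_superlinear:
  fixes F :: "real \<Rightarrow> real"
  assumes "a > 1" and F: "\<And>h. \<bar>F h\<bar> \<le> \<bar>h\<bar> powr a"
  shows "(F has_real_derivative 0) (at 0)"
proof -
  have F0: "F 0 = 0" using F[of 0] by simp
  have "((\<lambda>h. \<bar>h\<bar> powr (a - 1)) \<longlongrightarrow> \<bar>0::real\<bar> powr (a - 1)) (at 0)"
    using assms(1) by (intro tendsto_powr' tendsto_intros) auto
  then have lim: "((\<lambda>h::real. \<bar>h\<bar> powr (a - 1)) \<longlongrightarrow> 0) (at 0)" by simp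
  have "\<bar>F h / h\<bar> \<le> \<bar>h\<bar> powr (a - 1)" if "h \<noteq> 0" for h
    using F[of h] that by (simp add: powr_diff divide_right_mono)
  then have "((\<lambda>h. F h / h) \<longlongrightarrow> 0) (at 0)"
    by (intro Lim_null_comparison[OF _ lim]) (auto simp: eventually_at_filter)
  then show ?thesis by (simp add: DERIV_def F0)
qed

lemma DERIV_abs_powr:
  fixes a :: real
  assumes "a > 1"
  shows "((\<lambda>w. \<bar>w\<bar> powr a) has_real_derivative a * (sgn w * \<bar>w\<bar> powr (a - 1))) (at w)"
proof (cases w "0::real" rule: linorder_cases)
  case less
  have "((\<lambda>w. (- w) powr a) has_real_derivative a * (sgn w * \<bar>w\<bar> powr (a - 1))) (at w)"
    using less by (auto intro!: derivative_eq_intros simp: sgn_if)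
  then show ?thesis
    by (rule has_field_derivative_transform_within_open[where S = "{..<0}"]) (use less in auto)
next
  case equal
  then show ?thesis using DERIV_zero_if_superlinear[OF assms, of "\<lambda>w. \<bar>w\<bar> powr a"] by simp
next
  case greater
  have "((\<lambda>w. w powr a) has_real_derivative a * (sgn w * \<bar>w\<bar> powr (a - 1))) (at w)"
    using greater by (auto intro!: derivative_eq_intros simp: sgn_if)
  then show ?thesis
    by (rule has_field_derivative_transform_within_open[where S = "{0<..}"]) (use greater in auto)
qed

lemma DERIV_sgn_abs_powr:
  fixes a :: real
  assumes "a > 1"
  shows "((\<lambda>w. sgn w * \<bar>w\<bar> powr a) has_real_derivative a * \<bar>w\<bar> powr (a - 1)) (at w)"
proof (cases w "0::real" rule: linorder_cases)
  case less
  have "((\<lambda>w. - ((- w) powr a)) has_real_derivative a * \<bar>w\<bar> powr (a - 1)) (at w)"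
    using less by (auto intro!: derivative_eq_intros)
  then show ?thesis
    by (rule has_field_derivative_transform_within_open[where S = "{..<0}"]) (use less in auto)
next
  case equal
  then show ?thesis
    using DERIV_zero_if_superlinear[OF assms, of "\<lambda>w. sgn w * \<bar>w\<bar> powr a"]
    by (simp add: abs_mult sgn_if)
next
  case greater
  have "((\<lambda>w. w powr a) has_real_derivative a * \<bar>w\<bar> powr (a - 1)) (at w)"
    using greater by (auto intro!: derivative_eq_intros)
  then show ?thesis
    by (rule has_field_derivative_transform_within_open[where S = "{0<..}"]) (use greater in auto)
qed

text \<open>With \<open>q = 1 / (1 - \<alpha>)\<close> the exponent is \<open>p = q + 1\<close>, and \<open>q - 1 = q * \<alpha>\<close> turns
  \<open>\<bar>f'\<bar>\<^sup>\<alpha> = p\<^sup>\<alpha> * \<bar>w\<bar>\<^sup>q\<^sup>\<alpha>\<close> into a constant multiple of \<open>f'' = p * q * \<bar>w\<bar>\<^sup>q\<^sup>-\<^sup>1\<close>.\<close>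

lemma power_example:
  fixes \<alpha> :: real
  assumes \<alpha>: "0 < \<alpha>" "\<alpha> < 1"
  defines "f \<equiv> \<lambda>w::real. \<bar>w\<bar> powr ((2 - \<alpha>) / (1 - \<alpha>))"
  shows "f \<in> L_sym \<alpha>" and "0 < \<beta> \<Longrightarrow> \<beta> < \<alpha> \<Longrightarrow> f \<notin> L_sym \<beta>" and "f \<notin> L_asym"
proof -
  define q where "q = 1 / (1 - \<alpha>)"
  define p where "p = q + 1"
  have p: "(2 - \<alpha>) / (1 - \<alpha>) = p" using \<alpha> by (simp add: p_def q_def field_simps)
  have q: "q > 1" using \<alpha> by (simp add: q_def field_simps)
  have qa: "q - 1 = q * \<alpha>" using \<alpha> by (simp add: q_def field_simps)
  have f: "f = (\<lambda>w. \<bar>w\<bar> powr p)" by (simp add: f_def p)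
  let ?f' = "\<lambda>w::real. p * (sgn w * \<bar>w\<bar> powr q)"
  let ?f'' = "\<lambda>w::real. p * (q * \<bar>w\<bar> powr (q - 1))"
  have D1: "((\<lambda>w. \<bar>w\<bar> powr p) has_real_derivative ?f' w) (at w)" for w
    using DERIV_abs_powr[of p w] q by (simp add: p_def)
  have D2: "(?f' has_real_derivative ?f'' w) (at w)" for w
    by (rule DERIV_cmult[OF DERIV_sgn_abs_powr[OF q]])
  have abs_f': "\<bar>?f' w\<bar> = p * \<bar>w\<bar> powr q" for w
    using q by (simp add: abs_mult p_def sgn_if)
  have grad_f: "grad f = ?f'"
    using grad_ridge[OF D1, of "1::real"] by (simp add: f)
  \<comment> \<open>The factor for which \<open>f'' = K * \<bar>f'\<bar>\<^sup>\<alpha>\<close>.\<close>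
  define K where "K = p * q / p powr \<alpha>"
  have K: "K > 0" using q by (simp add: K_def p_def)
  have "(\<lambda>w. \<bar>w \<bullet> (1::real)\<bar> powr p) \<in> L_sym \<alpha>"
  proof (rule ridge_in_L_sym[OF _ D1 D2 _ zero_less_one K])
    fix t :: real
    have "rpow \<bar>?f' t\<bar> \<alpha> = p powr \<alpha> * \<bar>t\<bar> powr (q - 1)"
      using \<alpha> q unfolding abs_f' by (simp add: rpow_def powr_mult powr_powr qa p_def)
    then have "K * rpow \<bar>?f' t\<bar> \<alpha> = ?f'' t" using q by (simp add: K_def p_def)
    moreover have "?f'' t \<ge> 0" using q by (simp add: p_def)
    ultimately show "\<bar>?f'' t\<bar> \<le> 1 + K * rpow \<bar>?f' t\<bar> \<alpha>" by linarith
  qed (use \<alpha> in auto)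
  then show "f \<in> L_sym \<alpha>" by (simp add: f)
  have f0: "grad f 0 = 0" by (simp add: grad_f)
  show "f \<notin> L_sym \<beta>" if \<beta>: "0 < \<beta>" "\<beta> < \<alpha>"
  proof
    assume "f \<in> L_sym \<beta>"
    moreover have "\<bar>grad f x\<bar> \<le> \<bar>grad f y\<bar>" if "0 \<le> x" "x \<le> y" for x y
      unfolding grad_f abs_f' using that q
      by (intro mult_left_mono powr_mono2) (auto simp: p_def)
    ultimately obtain L0 L1 where
      L: "L0 > 0" "L1 > 0" and G: "\<And>x. x \<ge> 0 \<Longrightarrow> \<bar>grad f x\<bar> \<le> (L0 + L1 * rpow \<bar>grad f x\<bar> \<beta>) * x"
      using L_sym_imp_growth[of f \<beta>] f0 \<beta> by auto
    have pos: "p > 0" using q by (simp add: p_def)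
    have "q * \<beta> < q * \<alpha>" using q \<beta> by simp
    then have exps: "q * \<beta> + 1 < q" using qa by linarith
    have ev: "eventually (\<lambda>x::real. p * x powr q > (L0 + c * x powr r) * x) at_top"
      if "c > 0" "r > 0" "r + 1 < q" for c r
      using that pos q L by real_asymp
    have "eventually (\<lambda>x::real. p * x powr q
        > (L0 + L1 * (p powr \<beta> * x powr (q * \<beta>))) * x) at_top"
      using ev[of "L1 * p powr \<beta>" "q * \<beta>"] L pos q \<beta> exps by (simp add: mult.assoc)
    then have "eventually (\<lambda>x::real. p * x powr q
        > (L0 + L1 * (p powr \<beta> * x powr (q * \<beta>))) * x \<and> x > 0) at_top"
      using eventually_gt_at_top[of 0] by (rule eventually_conj)
    then obtain x :: real where
      x: "p * x powr q > (L0 + L1 * (p powr \<beta> * x powr (q * \<beta>))) * x" "x > 0"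
      by (auto simp: eventually_at_top_linorder)
    show False using G[of x] x \<beta> pos unfolding grad_f abs_f'
      by (simp add: rpow_def powr_mult powr_powr)
  qed
  show "f \<notin> L_asym"
  proof
    assume "f \<in> L_asym"
    from L_asym_imp_linear_growth[OF this f0] obtain L where
      L: "\<And>x. \<bar>grad f x\<bar> \<le> L * \<bar>x\<bar>" by auto
    have "p > 0" using q by (simp add: p_def)
    then have "eventually (\<lambda>x::real. p * x powr q > L * x) at_top"
      using q by real_asymp
    then have "eventually (\<lambda>x::real. p * x powr q > L * x \<and> x > 0) at_top"
      using eventually_gt_at_top[of 0] by (rule eventually_conj)
    then obtain x :: real where "p * x powr q > L * x" "x > 0"
      by (auto simp: eventually_at_top_linorder)
    then show False using L[of x] unfolding grad_f abs_f' by simp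
  qed
qed

section \<open>A function with Lipschitz but nondifferentiable gradient\<close>

text \<open>At its minimum \<open>0\<close> a derivative would have to vanish, but the difference quotients have
  absolute value \<open>1\<close>.\<close>

lemma not_differentiable_abs_0: "\<not> (\<lambda>t::real. \<bar>t\<bar>) differentiable (at 0)"
proof
  assume "(\<lambda>t::real. \<bar>t\<bar>) differentiable (at 0)"
  then obtain D where D: "((\<lambda>t::real. \<bar>t\<bar>) has_real_derivative D) (at 0)"
    by (auto simp: real_differentiable_def)
  have "D = 0" using DERIV_local_min[OF D zero_less_one] by simp
  with D have "((\<lambda>h::real. \<bar>h\<bar> / h) \<longlongrightarrow> 0) (at 0)" by (simp add: DERIV_def)
  then have "((\<lambda>h::real. \<bar>\<bar>h\<bar> / h\<bar>) \<longlongrightarrow> 0) (at 0)" by (rule tendsto_rabs_zero)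
  moreover have "((\<lambda>h::real. \<bar>\<bar>h\<bar> / h\<bar>) \<longlongrightarrow> 1) (at 0)"
    by (rule tendsto_eventually) (auto simp: eventually_at_filter)
  ultimately show False using tendsto_unique[of "at (0::real)"] by force
qed

lemma signed_square_ridge:
  fixes b :: "'a::euclidean_space"
  assumes b: "b \<in> Basis"
  defines "f \<equiv> \<lambda>x. sgn (x \<bullet> b) * \<bar>x \<bullet> b\<bar> powr 2"
  shows "f \<in> L_sym 1" and "\<not> twice_differentiable f"
proof -
  have D: "((\<lambda>t. sgn t * \<bar>t\<bar> powr 2) has_real_derivative 2 * \<bar>t\<bar>) (at t)" for t :: real
    using DERIV_sgn_abs_powr[of 2 t] by simp
  have grad_f: "grad f = (\<lambda>x. (2 * \<bar>x \<bullet> b\<bar>) *\<^sub>R b)"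
    unfolding f_def by (rule grad_ridge[OF D])
  show "f \<in> L_sym 1"
  proof (rule L_symI[of _ _ 2 1])
    show "f differentiable (at w)" for w
      unfolding f_def by (rule differentiable_ridge[OF D])
    show "continuous_on UNIV (grad f)"
      unfolding grad_f by (intro continuous_intros)
    fix w w' :: 'a and M
    assume M: "\<And>\<theta>. \<theta> \<in> {0..1} \<Longrightarrow> rpow (norm (grad f (\<theta> *\<^sub>R w' + (1 - \<theta>) *\<^sub>R w))) 1 \<le> M"
    have "M \<ge> 0" using order_trans[OF rpow_nonneg M[of 0]] by simp
    have norm_b: "norm ((2 * c) *\<^sub>R b) = 2 * \<bar>c\<bar>" for c
      using b by (simp add: abs_mult)
    have "norm (grad f w' - grad f w) = 2 * \<bar>\<bar>w' \<bullet> b\<bar> - \<bar>w \<bullet> b\<bar>\<bar>"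
      unfolding grad_f scaleR_diff_left[symmetric] right_diff_distrib[symmetric] by (rule norm_b)
    also have "\<dots> \<le> 2 * \<bar>(w' - w) \<bullet> b\<bar>" by (simp add: inner_diff_left)
    also have "\<dots> \<le> 2 * norm (w' - w)" using b by (simp add: Basis_le_norm)
    also have "\<dots> \<le> (2 + 1 * M) * norm (w' - w)"
      using \<open>M \<ge> 0\<close> by (intro mult_right_mono) auto
    finally show "norm (grad f w' - grad f w) \<le> (2 + 1 * M) * norm (w' - w)" .
  qed auto
  show "\<not> twice_differentiable f"
  proof
    assume "twice_differentiable f"
    then have "grad f differentiable (at (0 *\<^sub>R b))"
      by (simp add: twice_differentiable_def)
    \<comment> \<open>Restricting the gradient to the line through \<open>b\<close> recovers the absolute value.\<close>
    then have "(\<lambda>t::real. grad f (t *\<^sub>R b)) differentiable (at 0)"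
      by (rule differentiable_compose) (intro differentiable_scaleR, auto)
    then have "(\<lambda>t::real. (1 / 2) * (grad f (t *\<^sub>R b) \<bullet> b)) differentiable (at 0)"
      by (intro differentiable_mult differentiable_inner) auto
    then show False using not_differentiable_abs_0 b by (simp add: grad_f)
  qed
qed

section \<open>The hierarchy\<close>

theorem theorem1:
  shows "(L_asym :: (real ^ 'n \<Rightarrow> real) set) \<subset> L_sym 1 \<and>
    ((L_H :: (real ^ 'n \<Rightarrow> real) set) \<subset> L_sym 1 \<and>
     (L_H :: (real ^ 'n \<Rightarrow> real) set) \<inter> Collect twice_differentiable
       = L_sym 1 \<inter> Collect twice_differentiable) \<and>
    (\<forall>\<alpha>::real. 0 < \<alpha> \<and> \<alpha> < 1 \<longrightarrow>
      (let f = (\<lambda>w::real. \<bar>w\<bar> powr ((2 - \<alpha>) / (1 - \<alpha>))) in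
        f \<in> L_sym \<alpha> \<and> (\<forall>\<beta>. 0 < \<beta> \<and> \<beta> < \<alpha> \<longrightarrow> f \<notin> L_sym \<beta>) \<and> f \<notin> L_asym)) \<and>
    (let f = (\<lambda>w::real. exp w + exp (- w)) in
      f \<in> L_sym 1 \<and> (\<forall>\<beta>. 0 < \<beta> \<and> \<beta> < 1 \<longrightarrow> f \<notin> L_sym \<beta>) \<and> f \<notin> L_asym)"
proof (intro conjI)
  obtain b :: "real ^ 'n" where b: "b \<in> Basis" using nonempty_Basis by blast
  show "(L_asym :: (real ^ 'n \<Rightarrow> real) set) \<subset> L_sym 1"
    using L_asym_subset_L_sym_1 exp_ridge_in_L_sym_1[OF b] exp_ridge_notin_L_asym[OF b] by blast
  have "(\<lambda>x. sgn (x \<bullet> b) * \<bar>x \<bullet> b\<bar> powr 2) \<notin> L_H"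
    using signed_square_ridge(2)[OF b] by (simp add: L_H_def)
  then show "(L_H :: (real ^ 'n \<Rightarrow> real) set) \<subset> L_sym 1"
    using L_H_subset_L_sym_1 signed_square_ridge(1)[OF b] by blast
  show "(L_H :: (real ^ 'n \<Rightarrow> real) set) \<inter> Collect twice_differentiable
      = L_sym 1 \<inter> Collect twice_differentiable"
    using L_H_subset_L_sym_1 L_sym_1_imp_L_H by blast
  show "\<forall>\<alpha>::real. 0 < \<alpha> \<and> \<alpha> < 1 \<longrightarrow>
      (let f = (\<lambda>w::real. \<bar>w\<bar> powr ((2 - \<alpha>) / (1 - \<alpha>))) in
        f \<in> L_sym \<alpha> \<and> (\<forall>\<beta>. 0 < \<beta> \<and> \<beta> < \<alpha> \<longrightarrow> f \<notin> L_sym \<beta>) \<and> f \<notin> L_asym)"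
    unfolding Let_def using power_example by blast
  show "let f = (\<lambda>w::real. exp w + exp (- w)) in
      f \<in> L_sym 1 \<and> (\<forall>\<beta>. 0 < \<beta> \<and> \<beta> < 1 \<longrightarrow> f \<notin> L_sym \<beta>) \<and> f \<notin> L_asym"
    unfolding Let_def
    using exp_ridge_in_L_sym_1[of "1::real"] exp_ridge_notin_L_asym[of "1::real"] exp_notin_L_sym
    by simp
qed

end
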